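(* Let $G$ be an interval graph such that every vertex of $G$ belongs to at most $2$ maximal cliques of $G$, and let $H$ be a bipartite spanning subgraph of $G$. Then $\mathrm{BBC}_2(G,H)\leq \omega(G)+3$.
   Context: All graphs are finite and simple. For a positive integer $k$, $[k]=\{1,\dots,k\}$. Given a graph $G$, a subgraph $H$ of $G$ (called the backbone), and positive integers $q,k$, a $q$-backbone $k$-colouring of $(G,H)$ is a map $c:V(G)\to[k]$ such that $c(u)\neq c(v)$ for every edge $uv\in E(G)$ and $|c(u)-c(v)|\geq q$ for every edge $uv\in E(H)$. The $q$-backbone chromatic number $\mathrm{BBC}_q(G,H)$ is the minimum $k$ for which a $q$-backbone $k$-colouring of $(G,H)$ exists. $\omega(G)$ is the clique number of $G$. A graph is an interval graph if its vertices can be assigned (injectively) intervals of the real line so that two vertices are adjacent iff their intervals intersect. A clique is maximal if it is not contained in a larger clique. *)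

theory Defs
  imports "HOL-Analysis.Analysis" "HOL-Library.Ramsey"
begin

record 'a ugraph =
  verts :: "'a set"
  edges :: "'a set set"

definition simple_graph :: "'a ugraph \<Rightarrow> bool" where
  "simple_graph G \<longleftrightarrow>
     finite (verts G) \<and> (\<forall>e\<in>edges G. e \<subseteq> verts G \<and> card e = 2)"

definition subgraph :: "'a ugraph \<Rightarrow> 'a ugraph \<Rightarrow> bool" where
  "subgraph H G \<longleftrightarrow>
     simple_graph H \<and> verts H \<subseteq> verts G \<and> edges H \<subseteq> edges G"

definition spanning_subgraph :: "'a ugraph \<Rightarrow> 'a ugraph \<Rightarrow> bool" where
  "spanning_subgraph H G \<longleftrightarrow> subgraph H G \<and> verts H = verts G"

definition bipartite :: "'a ugraph \<Rightarrow> bool" where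
  "bipartite G \<longleftrightarrow>
     (\<exists>A B. A \<union> B = verts G \<and> A \<inter> B = {} \<and>
        (\<forall>e\<in>edges G. \<exists>a\<in>A. \<exists>b\<in>B. e = {a, b}))"

definition clique_in :: "'a ugraph \<Rightarrow> 'a set \<Rightarrow> bool" where
  "clique_in G K \<longleftrightarrow> K \<subseteq> verts G \<and> clique K (edges G)"

definition maximal_clique :: "'a ugraph \<Rightarrow> 'a set \<Rightarrow> bool" where
  "maximal_clique G K \<longleftrightarrow> clique_in G K \<and> (\<nexists>L. clique_in G L \<and> K \<subset> L)"

definition clique_number :: "'a ugraph \<Rightarrow> nat" where
  "clique_number G = Max {card K | K. clique_in G K}"

text \<open>Intervals may be open, closed, half-open or unbounded, but are nonempty.\<close>

definition interval_graph :: "'a ugraph \<Rightarrow> bool" where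
  "interval_graph G \<longleftrightarrow> simple_graph G \<and>
     (\<exists>I :: 'a \<Rightarrow> real set.
        inj_on I (verts G) \<and>
        (\<forall>v\<in>verts G. is_interval (I v) \<and> I v \<noteq> {}) \<and>
        (\<forall>u\<in>verts G. \<forall>v\<in>verts G. u \<noteq> v \<longrightarrow>
           ({u, v} \<in> edges G \<longleftrightarrow> I u \<inter> I v \<noteq> {})))"

definition backbone_colouring ::
    "nat \<Rightarrow> nat \<Rightarrow> 'a ugraph \<Rightarrow> 'a ugraph \<Rightarrow> ('a \<Rightarrow> nat) \<Rightarrow> bool" where
  "backbone_colouring q k G H c \<longleftrightarrow>
     (\<forall>v\<in>verts G. c v \<in> {1..k}) \<and>
     (\<forall>u v. {u, v} \<in> edges G \<longrightarrow> c u \<noteq> c v) \<and>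
     (\<forall>u v. {u, v} \<in> edges H \<longrightarrow> \<bar>int (c u) - int (c v)\<bar> \<ge> int q)"

definition BBC :: "nat \<Rightarrow> 'a ugraph \<Rightarrow> 'a ugraph \<Rightarrow> nat" where
  "BBC q G H = (LEAST k. k \<ge> 1 \<and> (\<exists>c. backbone_colouring q k G H c))"

text \<open>The minimum in the definition of \<^const>\<open>BBC\<close> is attained.\<close>

lemma backbone_colouring_exists:
  assumes "simple_graph G" "subgraph H G" "q \<ge> 1"
  shows "\<exists>k\<ge>1. \<exists>c. backbone_colouring q k G H c"
proof -
  have "finite (verts G)" using assms(1) by (simp add: simple_graph_def)
  then obtain f :: "'a \<Rightarrow> nat" and n where f: "f ` verts G = {i. i < n}" "inj_on f (verts G)"
    using finite_imp_inj_to_nat_seg by metis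
  define c where "c v = 1 + q * f v" for v
  have edge: "u \<in> verts G \<and> v \<in> verts G \<and> u \<noteq> v" if "{u, v} \<in> edges G" for u v
    using that assms(1) by (fastforce simp: simple_graph_def)
  have far: "\<bar>int (c u) - int (c v)\<bar> \<ge> int q" if "{u, v} \<in> edges G" for u v
  proof -
    have "f u \<noteq> f v" using edge[OF that] f(2) by (auto dest: inj_onD)
    then have "\<bar>int (f u) - int (f v)\<bar> \<ge> 1" by linarith
    then have "int q * 1 \<le> int q * \<bar>int (f u) - int (f v)\<bar>"
      by (intro mult_left_mono) auto
    also have "\<dots> = \<bar>int (c u) - int (c v)\<bar>"
      by (simp add: c_def abs_mult flip: right_diff_distrib)
    finally show ?thesis by simp
  qed
  have "c v \<in> {1..1 + q * n}" if "v \<in> verts G" for v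
  proof -
    have "f v < n" using f(1) that by blast
    then show ?thesis by (simp add: c_def)
  qed
  moreover have "c u \<noteq> c v" if "{u, v} \<in> edges G" for u v
    using far[OF that] assms(3) by auto
  ultimately have "backbone_colouring q (1 + q * n) G H c"
    using far assms(2) by (auto simp: backbone_colouring_def subgraph_def)
  then show ?thesis by (meson le_add1)
qed

end

theory Submission
  imports Defs
begin

text \<open>By Helly's theorem the maximal cliques of an interval graph are linearly ordered so that each
  vertex occupies a run of consecutive ones. If every vertex lies in at most two maximal cliques,
  each of them splits into the part shared with its predecessor, a private part, and the part
  shared with its successor. Colour the shared parts alternately at the bottom and at the top of
  the palette, always with side \<open>A\<close> of the bipartition below the other side and one skipped colour
  in between; their colours then do not depend on the clique from which they are seen. A private
  part goes between the two shared parts of its clique, with side \<open>A\<close> on top, so that a clique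
  skips at most three colours in total.\<close>

section \<open>Maximal cliques of an interval graph\<close>

lemma finite_cliques:
  assumes "simple_graph G"
  shows "finite {K. clique_in G K}"
  by (rule finite_subset[of _ "Pow (verts G)"])
    (use assms in \<open>auto simp: clique_in_def simple_graph_def\<close>)

lemma finite_maximal_cliques: "simple_graph G \<Longrightarrow> finite {K. maximal_clique G K}"
  by (rule finite_subset[OF _ finite_cliques]) (auto simp: maximal_clique_def)

lemma card_clique_le_clique_number:
  assumes "simple_graph G" "clique_in G K"
  shows "card K \<le> clique_number G"
  unfolding clique_number_def
  by (rule Max_ge) (use assms finite_cliques[OF assms(1)] in \<open>auto simp: setcompr_eq_image\<close>)

lemma clique_subset_maximal_clique:
  assumes "simple_graph G" "clique_in G L"
  shows "\<exists>K. maximal_clique G K \<and> L \<subseteq> K"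
  using finite_has_maximal2[OF finite_cliques[OF assms(1)], of L] assms(2)
  by (auto simp: maximal_clique_def psubset_eq)

lemma maximal_clique_absorbs:
  assumes "maximal_clique G K" "clique_in G L" "K \<subseteq> L"
  shows "L = K"
  using assms by (auto simp: maximal_clique_def)

lemma finite_clique:
  assumes "simple_graph G" "clique_in G K"
  shows "finite K"
  using assms by (auto simp: clique_in_def simple_graph_def intro: finite_subset)

text \<open>Helly's theorem in dimension one. It needs at least two sets, so the empty family and
  singletons are settled separately.\<close>

lemma pairwise_intersecting_intervals:
  fixes F :: "real set set"
  assumes "finite F" "\<And>s. s \<in> F \<Longrightarrow> is_interval s"
    and "\<And>s t. s \<in> F \<Longrightarrow> t \<in> F \<Longrightarrow> s \<inter> t \<noteq> {}"
  shows "\<Inter>F \<noteq> {}"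
proof (cases "card F \<le> 1")
  case True
  then consider "F = {}" | s where "F = {s}"
    using assms(1) by (metis card_1_singletonE card_eq_0_iff le_zero_eq le_Suc_eq One_nat_def)
  then show ?thesis using assms(3) by cases auto
next
  case False
  have "\<Inter>T \<noteq> {}" if T: "T \<subseteq> F" "card T = 2" for T
  proof -
    obtain s t where "T = {s, t}" using T(2) by (meson card_2_iff)
    then show ?thesis using assms(3) T(1) by auto
  qed
  with False assms(2) show ?thesis
    by - (rule Helly; simp add: is_interval_convex_1)
qed

text \<open>By Helly the intervals of a maximal clique \<open>K\<close> share a point
  \<open>p K\<close>. All vertices whose intervals contain \<open>p K\<close> form a clique around
  \<open>K\<close>, which by maximality is \<open>K\<close> itself; so \<open>p K\<close> determines
  \<open>K\<close>, and maximal cliques become points on the line.\<close>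

lemma maximal_clique_points:
  assumes "interval_graph G"
  obtains I :: "'a \<Rightarrow> real set" and p :: "'a set \<Rightarrow> real"
  where "\<And>v. v \<in> verts G \<Longrightarrow> is_interval (I v)"
    and "\<And>K v. maximal_clique G K \<Longrightarrow> v \<in> verts G \<Longrightarrow> v \<in> K \<longleftrightarrow> p K \<in> I v"
    and "inj_on p {K. maximal_clique G K}"
proof -
  have G: "simple_graph G" using assms by (simp add: interval_graph_def)
  from assms obtain I :: "'a \<Rightarrow> real set" where
    I: "\<forall>v\<in>verts G. is_interval (I v) \<and> I v \<noteq> {}"
    and "\<forall>u\<in>verts G. \<forall>v\<in>verts G. u \<noteq> v \<longrightarrow> ({u, v} \<in> edges G \<longleftrightarrow> I u \<inter> I v \<noteq> {})"
    unfolding interval_graph_def by (elim conjE exE) (rule that)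
  then have E: "{u, v} \<in> edges G \<longleftrightarrow> I u \<inter> I v \<noteq> {}"
    if "u \<in> verts G" "v \<in> verts G" "u \<noteq> v" for u v
    using that by blast
  have "\<exists>x. x \<in> \<Inter>(I ` K)" if "clique_in G K" for K
  proof -
    have K: "K \<subseteq> verts G" "\<And>u v. u \<in> K \<Longrightarrow> v \<in> K \<Longrightarrow> u \<noteq> v \<Longrightarrow> {u, v} \<in> edges G"
      using that by (auto simp: clique_in_def clique_def)
    have "I u \<inter> I v \<noteq> {}" if "u \<in> K" "v \<in> K" for u v
      using E[of u v] I K that by (cases "u = v") auto
    then have "\<Inter>(I ` K) \<noteq> {}"
      using K(1) I finite_clique[OF G that] by (intro pairwise_intersecting_intervals) auto
    then show ?thesis by blast
  qed
  then obtain p where p: "\<And>K v. clique_in G K \<Longrightarrow> v \<in> K \<Longrightarrow> p K \<in> I v"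
    by (metis INT_iff)
  define M where "M x = {v \<in> verts G. x \<in> I v}" for x
  have M: "clique_in G (M x)" for x
    using E by (auto simp: clique_in_def clique_def M_def)
  have max: "M (p K) = K" if "maximal_clique G K" for K
  proof (rule maximal_clique_absorbs[OF that M])
    show "K \<subseteq> M (p K)"
      using that p by (auto simp: M_def maximal_clique_def clique_in_def)
  qed
  show thesis
  proof
    show "is_interval (I v)" if "v \<in> verts G" for v using I that by blast
    show "v \<in> K \<longleftrightarrow> p K \<in> I v" if "maximal_clique G K" "v \<in> verts G" for K v
      using max[OF that(1)] that(2) by (auto simp: M_def)
    show "inj_on p {K. maximal_clique G K}"
      by (rule inj_onI) (metis max mem_Collect_eq)
  qed
qed

section \<open>Ranking the maximal cliques and classifying the vertices\<close>

abbreviation cliques_at :: "'a ugraph \<Rightarrow> 'a \<Rightarrow> 'a set set" where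
  "cliques_at G v \<equiv> {K. maximal_clique G K \<and> v \<in> K}"

text \<open>The rank counts the maximal cliques whose points lie further left. Were a third one
  strictly between two cliques of \<open>v\<close>, its point would lie in the interval of
  \<open>v\<close>, and \<open>v\<close> would belong to three maximal cliques.\<close>

lemma maximal_clique_rank:
  assumes G: "interval_graph G" and two: "\<forall>v\<in>verts G. card (cliques_at G v) \<le> 2"
  obtains r :: "'a set \<Rightarrow> nat"
  where "inj_on r {K. maximal_clique G K}"
    and "\<forall>v. \<forall>K\<in>cliques_at G v. \<forall>L\<in>cliques_at G v. K \<noteq> L \<longrightarrow>
           r L = Suc (r K) \<or> r K = Suc (r L)"
proof -
  let ?M = "{K. maximal_clique G K}"
  obtain I :: "'a \<Rightarrow> real set" and p where I: "\<And>v. v \<in> verts G \<Longrightarrow> is_interval (I v)"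
    and mem: "\<And>K v. maximal_clique G K \<Longrightarrow> v \<in> verts G \<Longrightarrow> v \<in> K \<longleftrightarrow> p K \<in> I v"
    and inj: "inj_on p ?M"
    by (rule maximal_clique_points[OF G]) (rule that; blast)
  have fin: "finite ?M" using G finite_maximal_cliques by (auto simp: interval_graph_def)
  define below where "below K = {L \<in> ?M. p L < p K}" for K
  have fb: "finite (below K)" for K using fin by (simp add: below_def)
  \<comment> \<open>\<open>K\<close> itself lies in \<open>below L\<close> but not in
    \<open>below K\<close>, so the inclusion is strict.\<close>
  have less: "card (below K) < card (below L)" if "K \<in> ?M" "p K < p L" for K L
    by (rule psubset_card_mono[OF fb]) (use that in \<open>force simp: below_def\<close>)
  have step: "card (below L) = Suc (card (below K))"
    if K: "K \<in> cliques_at G v" and L: "L \<in> cliques_at G v" and lt: "p K < p L" for v K L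
  proof -
    have v: "v \<in> verts G" using K by (auto simp: maximal_clique_def clique_in_def)
    \<comment> \<open>\<open>K\<close> is the only clique with point from \<open>p K\<close> up to
      but excluding \<open>p L\<close>, so passing from \<open>below K\<close> to
      \<open>below L\<close> adds just \<open>K\<close>.\<close>
    have "M = K" if M: "M \<in> ?M" "p K \<le> p M" "p M < p L" for M
    proof (rule ccontr)
      assume "M \<noteq> K"
      have neq: "K \<noteq> L" "M \<noteq> L" using lt M(3) by auto
      have "p M \<in> I v"
        using I[OF v] mem[OF _ v] K L M by (force intro: mem_is_interval_1_I)
      then have "{K, L, M} \<subseteq> cliques_at G v" using K L M mem[OF _ v] by auto
      moreover have "card {K, L, M} = 3" using \<open>M \<noteq> K\<close> neq by auto
      ultimately have "3 \<le> card (cliques_at G v)"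
        using fin card_mono[of "cliques_at G v" "{K, L, M}"] by auto
      then show False using two v by fastforce
    qed
    then have "below L = insert K (below K)"
      using K lt by (force simp: below_def)
    then show ?thesis using fb by (simp add: below_def)
  qed
  show thesis
  proof (rule that[of "\<lambda>K. card (below K)"])
    show "inj_on (\<lambda>K. card (below K)) ?M"
      using less inj by (intro inj_onI) (metis inj_onD linorder_neqE_linordered_idom less_irrefl)
    show "\<forall>v. \<forall>K\<in>cliques_at G v. \<forall>L\<in>cliques_at G v. K \<noteq> L \<longrightarrow>
        card (below L) = Suc (card (below K)) \<or> card (below K) = Suc (card (below L))"
      using step inj_onD[OF inj] by (metis (mono_tags, lifting) linorder_neqE_linordered_idom mem_Collect_eq)
  qed
qed

datatype kind = Low | Mid | High

text \<open>Vertices shared by the \<open>i\<close>-th and the next maximal clique are \<^const>\<open>Low\<close> or \<^const>\<open>High\<close>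
  according to the parity of \<open>i\<close>.\<close>

lemma vertex_kinds:
  assumes G: "interval_graph G" and two: "\<forall>v\<in>verts G. card (cliques_at G v) \<le> 2"
  obtains t :: "'a \<Rightarrow> kind"
  where "\<forall>v. \<forall>K\<in>cliques_at G v. t v = Mid \<longrightarrow> cliques_at G v = {K}"
    and "\<forall>u v. cliques_at G u \<inter> cliques_at G v \<noteq> {} \<longrightarrow> t u = t v \<longrightarrow>
           cliques_at G u = cliques_at G v"
proof -
  obtain r :: "'a set \<Rightarrow> nat" where inj: "inj_on r {K. maximal_clique G K}"
    and "\<forall>v. \<forall>K\<in>cliques_at G v. \<forall>L\<in>cliques_at G v. K \<noteq> L \<longrightarrow>
           r L = Suc (r K) \<or> r K = Suc (r L)"
    by (rule maximal_clique_rank[OF G two])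
  then have r: "r L = Suc (r K) \<or> r K = Suc (r L)"
    if "K \<in> cliques_at G v" "L \<in> cliques_at G v" "K \<noteq> L" for v K L
    using that by blast
  have fin: "finite (cliques_at G v)" for v
    using G finite_maximal_cliques[of G] by (auto simp: interval_graph_def)
  \<comment> \<open>The smaller rank tells which two cliques share the vertex. A clique of rank
    \<open>i\<close> shares vertices only with ranks \<open>i - 1\<close> and \<open>i + 1\<close>,
    so the smaller ranks seen from it are \<open>i - 1\<close> and \<open>i\<close>, of opposite
    parity.\<close>
  define t where "t v = (if card (cliques_at G v) \<le> 1 then Mid
      else if even (Min (r ` cliques_at G v)) then Low else High)" for v
  have mid: "cliques_at G v = {K}" if "K \<in> cliques_at G v" "t v = Mid" for K v
  proof -
    have "card (cliques_at G v) \<le> Suc 0" using that(2) by (auto simp: t_def split: if_splits)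
    then show ?thesis using that(1) card_le_Suc0_iff_eq[OF fin] by blast
  qed
  have other: "\<exists>L. cliques_at G v = {K, L} \<and> L \<in> cliques_at G v \<and> L \<noteq> K \<and>
      (t v = Low \<longleftrightarrow> even (min (r K) (r L)))"
    if K: "K \<in> cliques_at G v" and nm: "t v \<noteq> Mid" for K v
  proof -
    have "v \<in> verts G" using K by (auto simp: maximal_clique_def clique_in_def)
    then have c: "card (cliques_at G v) = 2"
      using two nm by (fastforce simp: t_def split: if_splits)
    then obtain L where L: "cliques_at G v = {K, L}" "L \<noteq> K"
      using K unfolding card_2_iff by (metis doubleton_eq_iff insertE singletonD)
    have "t v = Low \<longleftrightarrow> even (Min (r ` cliques_at G v))" using c by (simp add: t_def)
    then have "t v = Low \<longleftrightarrow> even (min (r K) (r L))" unfolding L(1) by simp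
    with L show ?thesis by blast
  qed
  have same: "cliques_at G u = cliques_at G v"
    if u: "K \<in> cliques_at G u" and v: "K \<in> cliques_at G v" and eq: "t u = t v" for K u v
  proof (cases "t u = Mid")
    case True
    then show ?thesis using mid u v eq by metis
  next
    case False
    obtain L where L: "cliques_at G u = {K, L}" "L \<in> cliques_at G u" "L \<noteq> K"
      "t u = Low \<longleftrightarrow> even (min (r K) (r L))"
      using other[OF u False] by blast
    obtain M where M: "cliques_at G v = {K, M}" "M \<in> cliques_at G v" "M \<noteq> K"
      "t v = Low \<longleftrightarrow> even (min (r K) (r M))"
      using other[OF v] False eq by metis
    \<comment> \<open>The other clique ranks one below or one above \<open>K\<close>, so the minimum
      is \<open>r K - 1\<close> or \<open>r K\<close>, and its parity tells which.\<close>
    have "even (min (r K) (r L)) \<longleftrightarrow> even (min (r K) (r M))" using L(4) M(4) eq by simp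
    then have "r L = r M"
      using r[OF u L(2) L(3)[symmetric]] r[OF v M(2) M(3)[symmetric]] by auto
    then have "L = M" using inj L(2) M(2) by (auto dest: inj_onD)
    then show ?thesis using L(1) M(1) by simp
  qed
  show thesis
  proof (rule that)
    show "\<forall>v. \<forall>K\<in>cliques_at G v. t v = Mid \<longrightarrow> cliques_at G v = {K}" using mid by blast
    show "\<forall>u v. cliques_at G u \<inter> cliques_at G v \<noteq> {} \<longrightarrow> t u = t v \<longrightarrow>
        cliques_at G u = cliques_at G v"
      using same by blast
  qed
qed

section \<open>Colouring a single clique\<close>

text \<open>The enumeration is arbitrary but depends on the set \<open>X\<close> alone, so two
  cliques with the same block give its vertices the same positions.\<close>

definition position :: "'a set \<Rightarrow> 'a \<Rightarrow> nat" where
  "position X = (SOME h. bij_betw h X {0..<card X})"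

lemma bij_betw_position: "finite X \<Longrightarrow> bij_betw (position X) X {0..<card X}"
  unfolding position_def using someI_ex[OF ex_bij_betw_finite_nat] .

lemma position_less: "finite X \<Longrightarrow> v \<in> X \<Longrightarrow> position X v < card X"
  using bij_betw_position[of X] by (auto dest: bij_betwE)

lemma position_inj:
  "finite X \<Longrightarrow> u \<in> X \<Longrightarrow> v \<in> X \<Longrightarrow> position X u = position X v \<Longrightarrow> u = v"
  using bij_betw_position[of X] by (auto simp: bij_betw_def dest: inj_onD)

definition block :: "('a \<Rightarrow> kind) \<Rightarrow> 'a set \<Rightarrow> 'a set \<Rightarrow> 'a \<Rightarrow> 'a set" where
  "block t A K v = {w \<in> K. t w = t v \<and> (w \<in> A \<longleftrightarrow> v \<in> A)}"

definition num :: "('a \<Rightarrow> kind) \<Rightarrow> 'a set \<Rightarrow> 'a set \<Rightarrow> kind \<Rightarrow> bool \<Rightarrow> nat" where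
  "num t A K k s = card {w \<in> K. t w = k \<and> (w \<in> A \<longleftrightarrow> s)}"

text \<open>From bottom to top the colours of \<open>K\<close> form the blocks \<open>Low \<inter> A\<close>, \<open>Low - A\<close>, \<open>Mid - A\<close>,
  \<open>Mid \<inter> A\<close>, \<open>High \<inter> A\<close>, \<open>High - A\<close>. The side of \<open>A\<close> changes three times, and one colour is
  skipped at each change.\<close>

definition block_start :: "nat \<Rightarrow> ('a \<Rightarrow> kind) \<Rightarrow> 'a set \<Rightarrow> 'a set \<Rightarrow> kind \<Rightarrow> bool \<Rightarrow> nat" where
  "block_start n t A K k s =
    (case k of
       Low \<Rightarrow> if s then 1 else num t A K Low True + 2
     | Mid \<Rightarrow> num t A K Low True + num t A K Low False + 2
                + (if s then num t A K Mid False + 1 else 0)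
     | High \<Rightarrow> if s then n - num t A K High True - num t A K High False
               else n + 1 - num t A K High False)"

definition clique_colour :: "nat \<Rightarrow> ('a \<Rightarrow> kind) \<Rightarrow> 'a set \<Rightarrow> 'a set \<Rightarrow> 'a \<Rightarrow> nat" where
  "clique_colour n t A K v =
    block_start n t A K (t v) (v \<in> A) + position (block t A K v) v"

lemma card_eq_sum_num:
  assumes "finite K"
  shows "card K = num t A K Low True + num t A K Low False + num t A K Mid True
    + num t A K Mid False + num t A K High True + num t A K High False"
proof -
  define S where "S k s = {w \<in> K. t w = k \<and> (w \<in> A \<longleftrightarrow> s)}" for k s
  have fin: "finite (S k s)" for k s using assms by (simp add: S_def)
  have dis: "S k s \<inter> S k' s' = {}" if "(k, s) \<noteq> (k', s')" for k s k' s'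
    using that by (auto simp: S_def)
  have "K = S Low True \<union> S Low False \<union> S Mid True \<union> S Mid False \<union> S High True \<union> S High False"
    by (auto simp: S_def) (metis kind.exhaust)+
  then have "card K = card (S Low True \<union> S Low False \<union> S Mid True \<union> S Mid False
      \<union> S High True \<union> S High False)" by simp
  also have "\<dots> = card (S Low True) + card (S Low False) + card (S Mid True)
    + card (S Mid False) + card (S High True) + card (S High False)"
    by (simp add: card_Un_disjoint fin dis Int_Un_distrib2)
  finally show ?thesis by (simp add: S_def num_def)
qed

lemma clique_colour_bounds:
  assumes "finite K" "v \<in> K"
  shows "block_start n t A K (t v) (v \<in> A) \<le> clique_colour n t A K v"
    and "clique_colour n t A K v < block_start n t A K (t v) (v \<in> A) + num t A K (t v) (v \<in> A)"
proof -
  have "position (block t A K v) v < card (block t A K v)"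
    using assms by (intro position_less) (auto simp: block_def)
  then show "clique_colour n t A K v
      < block_start n t A K (t v) (v \<in> A) + num t A K (t v) (v \<in> A)"
    by (simp add: clique_colour_def num_def block_def)
qed (simp add: clique_colour_def)

text \<open>Block ends are exclusive, so disjoint blocks already give distinct colours; the extra
  unit for different sides leaves a colour free in between and yields distance two.\<close>

lemma blocks_disjoint_in_range:
  assumes K: "finite K" "card K + 3 \<le> n"
  shows blocks_separated: "(k, s) \<noteq> (k', s') \<Longrightarrow>
      block_start n t A K k s + num t A K k s + of_bool (s \<noteq> s') \<le> block_start n t A K k' s' \<or>
      block_start n t A K k' s' + num t A K k' s' + of_bool (s \<noteq> s') \<le> block_start n t A K k s"
    and block_start_pos: "1 \<le> block_start n t A K k s"
    and block_end_le: "block_start n t A K k s + num t A K k s \<le> n + 1"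
proof -
  define a b c d e f where "a = num t A K Low True" and "b = num t A K Low False"
    and "c = num t A K Mid True" and "d = num t A K Mid False"
    and "e = num t A K High True" and "f = num t A K High False"
  note defs = this
  \<comment> \<open>One \<open>n\<close> is to serve every clique, and \<open>g\<close> is the slack
    that a smaller clique leaves. It falls between \<open>Mid\<close> and \<open>High\<close>, since
    \<open>High\<close> is counted down from \<open>n\<close>; with \<open>n\<close> in this form no
    subtraction is truncated.\<close>
  obtain g where n: "n = a + b + c + d + e + f + 3 + g"
    using le_Suc_ex[OF K(2)] card_eq_sum_num[OF K(1), of t A] by (auto simp: defs)
  have start: "block_start n t A K Low True = 1" "block_start n t A K Low False = a + 2"
    "block_start n t A K Mid False = a + b + 2" "block_start n t A K Mid True = a + b + d + 3"
    "block_start n t A K High True = a + b + c + d + 3 + g"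
    "block_start n t A K High False = a + b + c + d + e + 4 + g"
    by (simp_all add: block_start_def n flip: defs)
  note s = start defs[symmetric]
  show "block_start n t A K k s + num t A K k s + of_bool (s \<noteq> s') \<le> block_start n t A K k' s' \<or>
      block_start n t A K k' s' + num t A K k' s' + of_bool (s \<noteq> s') \<le> block_start n t A K k s"
    if "(k, s) \<noteq> (k', s')"
    using that by (cases k; cases k'; cases s; cases s') (simp_all add: s)
  show "1 \<le> block_start n t A K k s"
    by (cases k; cases s) (simp_all add: s)
  show "block_start n t A K k s + num t A K k s \<le> n + 1"
    unfolding n by (cases k; cases s) (simp_all add: s[unfolded n])
qed

lemma clique_colour_range:
  assumes "finite K" "card K + 3 \<le> n" "v \<in> K"
  shows "clique_colour n t A K v \<in> {1..n}"
  using clique_colour_bounds[OF assms(1,3), of n t A] block_start_pos[OF assms(1,2), of t A "t v" "v \<in> A"]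
    block_end_le[OF assms(1,2), of t A "t v" "v \<in> A"]
  by simp

lemma clique_colour_distinct:
  assumes K: "finite K" "card K + 3 \<le> n" and u: "u \<in> K" and v: "v \<in> K" and "u \<noteq> v"
  shows "clique_colour n t A K u \<noteq> clique_colour n t A K v"
proof (cases "t u = t v \<and> (u \<in> A \<longleftrightarrow> v \<in> A)")
  case True
  then have b: "block t A K u = block t A K v" by (auto simp: block_def)
  have "u \<in> block t A K v" "v \<in> block t A K v" using True u v by (auto simp: block_def)
  then have "position (block t A K v) u \<noteq> position (block t A K v) v"
    using position_inj[of "block t A K v" u v] K(1) \<open>u \<noteq> v\<close> by (auto simp: block_def)
  then show ?thesis using True b by (simp add: clique_colour_def)
next
  case False
  then have "(t u, u \<in> A) \<noteq> (t v, v \<in> A)" by auto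
  from blocks_separated[OF K this, of t A] show ?thesis
    using clique_colour_bounds[OF K(1) u, of n t A] clique_colour_bounds[OF K(1) v, of n t A]
    by linarith
qed

lemma clique_colour_far:
  assumes K: "finite K" "card K + 3 \<le> n" and u: "u \<in> K" "u \<in> A" and v: "v \<in> K" "v \<notin> A"
  shows "\<bar>int (clique_colour n t A K u) - int (clique_colour n t A K v)\<bar> \<ge> 2"
proof -
  have "(t u, u \<in> A) \<noteq> (t v, v \<in> A)" using u v by simp
  moreover have "of_bool ((u \<in> A) \<noteq> (v \<in> A)) = (1::nat)" using u v by simp
  ultimately show ?thesis
    using blocks_separated[OF K, of "t u" "u \<in> A" "t v" "v \<in> A" t A]
      clique_colour_bounds[OF K(1) u(1), of n t A] clique_colour_bounds[OF K(1) v(1), of n t A]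
    by linarith
qed

section \<open>Gluing the colourings of the maximal cliques\<close>

text \<open>A \<open>Mid\<close> vertex has only one maximal clique. For the other kinds, all
  cliques of \<open>v\<close> contain the same vertices of its kind, and the starts of
  \<open>Low\<close> and \<open>High\<close> refer to no other kind, being counted from the two ends
  of the palette.\<close>

lemma clique_colour_cong:
  assumes mid: "\<forall>v. \<forall>K\<in>cliques_at G v. t v = Mid \<longrightarrow> cliques_at G v = {K}"
    and same: "\<forall>u v. cliques_at G u \<inter> cliques_at G v \<noteq> {} \<longrightarrow> t u = t v \<longrightarrow>
           cliques_at G u = cliques_at G v"
    and K: "K \<in> cliques_at G v" and L: "L \<in> cliques_at G v"
  shows "clique_colour n t A K v = clique_colour n t A L v"
proof (cases "t v = Mid")
  case True
  have "K \<in> {L}" using K unfolding mid[rule_format, OF L True] .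
  then show ?thesis by simp
next
  case False
  \<comment> \<open>\<open>w\<close> and \<open>v\<close> have the same kind and meet in
    \<open>M\<close>, so by \<open>same\<close> they lie in the same cliques, among them
    \<open>N\<close>.\<close>
  have "w \<in> N" if t: "t w = t v" and M: "M \<in> cliques_at G v" "w \<in> M"
    and N: "N \<in> cliques_at G v" for w M N
  proof -
    have "M \<in> cliques_at G w \<inter> cliques_at G v" using M by simp
    then have "cliques_at G w \<inter> cliques_at G v \<noteq> {}" by force
    then have "cliques_at G w = cliques_at G v" using t by (rule same[rule_format])
    then have "N \<in> cliques_at G w" using N by (rule ssubst)
    then show ?thesis by simp
  qed
  from this[OF _ K _ L] this[OF _ L _ K] have "w \<in> K \<longleftrightarrow> w \<in> L" if "t w = t v" for w
    using that by metis
  then have eq: "{w \<in> K. t w = t v \<and> P w} = {w \<in> L. t w = t v \<and> P w}" for P by auto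
  then have "num t A K (t v) s = num t A L (t v) s" for s unfolding num_def by simp
  \<comment> \<open>The case \<open>Mid\<close> has to be excluded: its start also involves the
    \<open>Low\<close> counts, which may differ between cliques.\<close>
  then have "block_start n t A K (t v) s = block_start n t A L (t v) s" for s
    using False by (cases "t v") (auto simp: block_start_def)
  moreover have "block t A K v = block t A L v" using eq by (simp add: block_def)
  ultimately show ?thesis by (simp add: clique_colour_def)
qed

theorem theorem1:
  fixes G H :: "'a ugraph"
  assumes "interval_graph G"
    and "\<forall>v\<in>verts G. card {K. maximal_clique G K \<and> v \<in> K} \<le> 2"
    and "spanning_subgraph H G"
    and "bipartite H"
  shows "BBC 2 G H \<le> clique_number G + 3"
proof -
  let ?n = "clique_number G + 3"
  have G: "simple_graph G" using assms(1) by (simp add: interval_graph_def)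
  obtain t where mid: "\<forall>v. \<forall>K\<in>cliques_at G v. t v = Mid \<longrightarrow> cliques_at G v = {K}"
    and same: "\<forall>u v. cliques_at G u \<inter> cliques_at G v \<noteq> {} \<longrightarrow> t u = t v \<longrightarrow>
           cliques_at G u = cliques_at G v"
    by (rule vertex_kinds[OF assms(1,2)])
  obtain A where A: "\<And>e. e \<in> edges H \<Longrightarrow> \<exists>a\<in>A. \<exists>b. b \<notin> A \<and> e = {a, b}"
    using assms(4) unfolding bipartite_def by (metis disjoint_iff)
  \<comment> \<open>The choice of the clique is immaterial, so each constraint below can be checked
    inside whichever clique suits it.\<close>
  define c where "c v = clique_colour ?n t A (SOME K. K \<in> cliques_at G v) v" for v
  have c: "c v = clique_colour ?n t A K v" if "K \<in> cliques_at G v" for K v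
    unfolding c_def by (rule clique_colour_cong[OF mid same someI that]) (rule that)
  have K: "finite K" "card K + 3 \<le> ?n" if "maximal_clique G K" for K
    using that finite_clique[OF G] card_clique_le_clique_number[OF G]
    by (auto simp: maximal_clique_def)
  \<comment> \<open>An edge is a clique and extends to a maximal one, which reduces both edge
    conditions to a single clique.\<close>
  have edge: "\<exists>K. maximal_clique G K \<and> u \<in> K \<and> v \<in> K \<and> u \<noteq> v" if "{u, v} \<in> edges G" for u v
  proof -
    have uv: "u \<in> verts G" "v \<in> verts G" "u \<noteq> v"
      using that G by (fastforce simp: simple_graph_def)+
    then have "clique_in G {u, v}"
      using that by (auto simp: clique_in_def clique_def insert_commute)
    from clique_subset_maximal_clique[OF G this] uv(3) show ?thesis by auto
  qed
  have "backbone_colouring 2 ?n G H c"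
    unfolding backbone_colouring_def
  proof (intro conjI ballI allI impI)
    fix v assume "v \<in> verts G"
    then have "clique_in G {v}" by (simp add: clique_in_def clique_def)
    from clique_subset_maximal_clique[OF G this]
    obtain M where M: "maximal_clique G M" "v \<in> M" by auto
    have "c v = clique_colour ?n t A M v" using M by (intro c) simp
    then show "c v \<in> {1..?n}" by (simp only: clique_colour_range[OF K[OF M(1)] M(2)])
  next
    fix u v assume "{u, v} \<in> edges G"
    from edge[OF this] obtain M where M: "maximal_clique G M" "u \<in> M" "v \<in> M" "u \<noteq> v" by auto
    then show "c u \<noteq> c v"
      using clique_colour_distinct[OF K[OF M(1)] M(2,3,4)] c[of M u] c[of M v] by simp
  next
    fix u v assume H: "{u, v} \<in> edges H"
    then have "{u, v} \<in> edges G" using assms(3) by (auto simp: spanning_subgraph_def subgraph_def)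
    from edge[OF this] obtain M where M: "maximal_clique G M" "u \<in> M" "v \<in> M" by auto
    then have cM: "c u = clique_colour ?n t A M u" "c v = clique_colour ?n t A M v"
      using c[of M u] c[of M v] by simp_all
    from A[OF H] consider "u \<in> A" "v \<notin> A" | "v \<in> A" "u \<notin> A"
      by (metis doubleton_eq_iff)
    then show "\<bar>int (c u) - int (c v)\<bar> \<ge> int 2"
    proof cases
      case 1
      then show ?thesis
        unfolding cM using clique_colour_far[OF K[OF M(1)] M(2) 1(1) M(3) 1(2), of t] by simp
    next
      case 2
      then show ?thesis
        unfolding cM using clique_colour_far[OF K[OF M(1)] M(3) 2(1) M(2) 2(2), of t] by linarith
    qed
  qed
  then show ?thesis unfolding BBC_def by (intro Least_le) auto
qed

end
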